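(* Let $\mathcal{G} = \{\boldsymbol{x} \in \prod_{i=1}^{n} \mathcal{D}_i \mid g(\boldsymbol{x}) \leq b\}$ with $g(\boldsymbol{x}) = \sum_{j=1}^q g_j(\boldsymbol{x}_{H_j})$, where each $g_j:\mathbb{R}^{|H_j|} \to \mathbb{R}$ is a (possibly non-separable) function of the variables with indices in $H_j \subseteq [n]$. Let $\mathtt{D}$ be a decision diagram constructed by the relaxed-DD procedure with merging (described in the context) for some sub-domain partitions $\mathcal{D}^j_i$, $j \in L_i$, $i \in [n]$, some width limit $\omega$, and some merging oracle $\mathtt{Merge}(\omega,\cdot)$. Then $\mathrm{conv}(\mathcal{G}) \subseteq \mathrm{conv}(\mathrm{Sol}(\mathtt{D}))$.
   Context: Notation: $[n]=\{1,\dots,n\}$; $\boldsymbol{x}_H$ is the sub-vector of $\boldsymbol{x}$ with indices in $H$; $\mathrm{conv}$ is the convex hull. Each variable is either continuous, with $\mathcal{D}_i=[\mathcal{D}_i\!\downarrow,\mathcal{D}_i\!\uparrow]\subset\mathbb{R}$ a bounded closed interval, or integer, with $\mathcal{D}_i=[\mathcal{D}_i\!\downarrow,\mathcal{D}_i\!\uparrow]\cap\mathbb{Z}$ for integer endpoints. Each $H_k$ is nonempty and $H_k^{\max}=\max_{l\in H_k} l$. Decision diagram (DD): a directed acyclic multigraph $\mathtt{D}=(\mathtt{U},\mathtt{A},\mathtt{l}(\cdot))$ with node layers $\mathtt{U}_1,\dots,\mathtt{U}_{n+1}$ and arc layers $\mathtt{A}_1,\dots,\mathtt{A}_n$. $\mathtt{U}_1=\{\mathtt{r}\}$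 (root), $\mathtt{U}_{n+1}=\{\mathtt{t}\}$ (terminal). Each arc in $\mathtt{A}_i$ goes from a node in $\mathtt{U}_i$ to a node in $\mathtt{U}_{i+1}$ and has a real label $\mathtt{l}(\mathtt{a})$; parallel arcs are allowed. Each $\mathtt{r}$-$\mathtt{t}$ path $(\mathtt{a}_1,\dots,\mathtt{a}_n)$ encodes the point $(\mathtt{l}(\mathtt{a}_1),\dots,\mathtt{l}(\mathtt{a}_n))\in\mathbb{R}^n$, and $\mathrm{Sol}(\mathtt{D})$ is the set of all points so encoded. Sub-domain partitions: for each $i\in[n]$, $L_i$ is a finite index set and $\mathcal{D}_i^j$, $j\in L_i$, are sets of the form $[\mathcal{D}_i^j\!\downarrow,\mathcal{D}_i^j\!\uparrow]$ (or $[\mathcal{D}_i^j\!\downarrow,\mathcal{D}_i^j\!\uparrow]\cap\mathbb{Z}$ if $x_i$ is integer) with $\bigcup_{j\in L_i}\mathcal{D}_i^j=\mathcal{D}_i$. Relative sub-domain: for a node $\mathtt{u}\in\mathtt{U}_i$ and $l<i$, let $\mathtt{A}_l(\mathtt{u})$ be the set of arcs of arc layer $l$ that lie on a path from the root to $\mathtt{u}$; then $\mathcal{D}_l(\mathtt{u})=[\min_{\mathtt{a}\in \mathtt{A}_l(\mathtt{u})}\mathtt{l}(\mathtt{a}),\ \max_{\mathtt{a}\in \mathtt{A}_l(\mathtt{u})}\mathtt{l}(\mathtt{a})]$. Merging: to merge a set $\mathtt{V}$ of nodes of one layer means to replace them by a single new node $\tilde{\mathtt{v}}$ that inherits all incoming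 arcs (with their labels) of the nodes in $\mathtt{V}$ and has state value $\mathtt{s}(\tilde{\mathtt{v}})=\min_{\mathtt{v}\in\mathtt{V}}\mathtt{s}(\mathtt{v})$. A merging oracle $\mathtt{Merge}(\omega,\cdot)$, applied to the set of nodes of a layer, selects (by an arbitrary policy) disjoint subsets of nodes and merges each of them, so that the number of nodes remaining in the layer is at most $\omega\in\mathbb{N}$. Relaxed-DD procedure with merging. Create the root $\mathtt{r}$ with state value $\mathtt{s}(\mathtt{r})=0$ and the terminal $\mathtt{t}$. For $i=1,\dots,n$ in order: (1) for each $\mathtt{u}\in\mathtt{U}_i$ and each $j\in L_i$: for each $k\in[q]$, if $i=H_k^{\max}$, choose a real number $\eta_k$ with $\eta_k\le g_k(\boldsymbol{x}_{H_k})$ for all $x_i\in\mathcal{D}_i^j$ and all $x_l\in\mathcal{D}_l(\mathtt{u})$, $l\in H_k\setminus\{i\}$; otherwise set $\eta_k=0$. Put $\xi=\mathtt{s}(\mathtt{u})+\sum_{k=1}^q\eta_k$. If $i<n$, create in $\mathtt{U}_{i+1}$ a node $\mathtt{v}$ with state value $\mathtt{s}(\mathtt{v})=\xi$ (if such a node does not already exist) and add two arcs from $\mathtt{u}$ to $\mathtt{v}$ with labels $\mathcal{D}_i^j\!\downarrow$ and $\mathcal{D}_i^j\!\uparrow$. If $i=n$ and $\xi\le b$, add two arcs from $\mathtt{u}$ to $\mathtt{t}$ with labels $\mathcal{D}_n^j\!\downarrow$ and $\mathcal{D}_n^j\!\uparrow$. (2) if $i<n$, apply $\mathtt{Merge}(\omega,\mathtt{U}_{i+1})$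 to the nodes created in layer $i+1$. (Relative sub-domains of nodes of layer $i+1$ used in the next iteration are those of the diagram after merging.) *)

theory Defs
  imports
    "HOL-Analysis.Analysis"
    "HOL-Library.Function_Algebras"
    "HOL-Library.Disjoint_Sets"
begin

text \<open>
  A point of \<open>\<real>\<^sup>n\<close> is a function \<open>nat \<Rightarrow> real\<close> in \<open>extensional {1..n}\<close>, i.e. with the fixed value
  \<open>undefined\<close> outside \<open>{1..n}\<close>. These functions form an affine subspace of \<open>nat \<Rightarrow> real\<close> (with the
  pointwise operations) on which the coordinates \<open>1, \<dots>, n\<close> are affine coordinates, so that \<open>convex hull\<close>
  in \<open>nat \<Rightarrow> real\<close> is the convex hull in \<open>\<real>\<^sup>n\<close>.
\<close>

instantiation "fun" :: (type, real_vector) real_vector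
begin

definition scaleR_fun :: "real \<Rightarrow> ('a \<Rightarrow> 'b) \<Rightarrow> 'a \<Rightarrow> 'b" where
  "scaleR_fun r f = (\<lambda>x. r *\<^sub>R f x)"

instance
  by standard (auto simp: scaleR_fun_def fun_eq_iff scaleR_add_right scaleR_add_left)

end

lemma scaleR_fun_apply [simp]: "(r *\<^sub>R f) x = r *\<^sub>R f x"
  by (simp add: scaleR_fun_def)

lemma convex_extensional: "convex (extensional A :: ('a \<Rightarrow> real) set)"
  by (auto simp: convex_def extensional_def simp flip: distrib_right)


section \<open>The constraint\<close>

definition bounded_domain :: "bool \<Rightarrow> real \<Rightarrow> real \<Rightarrow> real set" where
  "bounded_domain int_var lo hi = (if int_var then {lo..hi} \<inter> \<int> else {lo..hi})"

record problem =
  nvars :: nat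
  nterms :: nat
  is_int :: "nat \<Rightarrow> bool"
  dom_lo :: "nat \<Rightarrow> real"
  dom_hi :: "nat \<Rightarrow> real"
  scope :: "nat \<Rightarrow> nat set"
  fn :: "nat \<Rightarrow> (nat \<Rightarrow> real) \<Rightarrow> real"
  rhs :: real

definition domain_of :: "problem \<Rightarrow> nat \<Rightarrow> real set" where
  "domain_of P i = bounded_domain (is_int P i) (dom_lo P i) (dom_hi P i)"

definition problem_wf :: "problem \<Rightarrow> bool" where
  "problem_wf P \<longleftrightarrow>
     1 \<le> nvars P \<and>
     (\<forall>i\<in>{1..nvars P}. is_int P i \<longrightarrow> dom_lo P i \<in> \<int> \<and> dom_hi P i \<in> \<int>) \<and>
     (\<forall>k\<in>{1..nterms P}. scope P k \<noteq> {} \<and> scope P k \<subseteq> {1..nvars P})"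

text \<open>
  The sub-vector of \<open>x\<close> indexed by \<open>H\<close> is \<open>restrict x H\<close>, so \<open>fn P k\<close> is only ever applied to elements of
  \<open>extensional (scope P k)\<close>.
\<close>

definition term_val :: "problem \<Rightarrow> nat \<Rightarrow> (nat \<Rightarrow> real) \<Rightarrow> real" where
  "term_val P k x = fn P k (restrict x (scope P k))"

definition feasible_set :: "problem \<Rightarrow> (nat \<Rightarrow> real) set" where
  "feasible_set P =
     {x \<in> PiE {1..nvars P} (domain_of P). (\<Sum>k = 1..nterms P. term_val P k x) \<le> rhs P}"

record 'j partition =
  idx :: "nat \<Rightarrow> 'j set"
  sub_lo :: "nat \<Rightarrow> 'j \<Rightarrow> real"
  sub_hi :: "nat \<Rightarrow> 'j \<Rightarrow> real"

definition subdomain :: "problem \<Rightarrow> 'j partition \<Rightarrow> nat \<Rightarrow> 'j \<Rightarrow> real set" where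
  "subdomain P S i j = bounded_domain (is_int P i) (sub_lo S i j) (sub_hi S i j)"

definition partition_wf :: "problem \<Rightarrow> 'j partition \<Rightarrow> bool" where
  "partition_wf P S \<longleftrightarrow>
     (\<forall>i\<in>{1..nvars P}. finite (idx S i) \<and> (\<Union>j\<in>idx S i. subdomain P S i j) = domain_of P i)"


section \<open>Decision diagrams\<close>

text \<open>
  A layered directed multigraph with arc labels; \<open>sval\<close> is the state value that the procedure below
  attaches to a node. The fields \<open>tail\<close>, \<open>head\<close>, \<open>label\<close> and \<open>sval\<close> are only relevant on the arcs and
  nodes that occur in some layer.
\<close>

record ('v, 'a) dd =
  root_node :: 'v
  terminal_node :: 'v
  nodes :: "nat \<Rightarrow> 'v set"
  arcs :: "nat \<Rightarrow> 'a set"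
  tail :: "'a \<Rightarrow> 'v"
  head :: "'a \<Rightarrow> 'v"
  label :: "'a \<Rightarrow> real"
  sval :: "'v \<Rightarrow> real"

definition decision_diagram :: "nat \<Rightarrow> ('v, 'a) dd \<Rightarrow> bool" where
  "decision_diagram n D \<longleftrightarrow>
     nodes D 1 = {root_node D} \<and> nodes D (n + 1) = {terminal_node D} \<and>
     (\<forall>i. finite (nodes D i) \<and> finite (arcs D i)) \<and>
     (\<forall>i. i \<notin> {1..n + 1} \<longrightarrow> nodes D i = {}) \<and> (\<forall>i. i \<notin> {1..n} \<longrightarrow> arcs D i = {}) \<and>
     disjoint_family (nodes D) \<and> disjoint_family (arcs D) \<and>
     (\<forall>i\<in>{1..n}. \<forall>a\<in>arcs D i. tail D a \<in> nodes D i \<and> head D a \<in> nodes D (i + 1))"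

text \<open>\<open>dd_path D i u p v\<close>: the list \<open>p\<close> of arcs, from the arc layers \<open>i, i + 1, \<dots>\<close>, is a path from \<open>u\<close> to \<open>v\<close>.\<close>

fun dd_path :: "('v, 'a) dd \<Rightarrow> nat \<Rightarrow> 'v \<Rightarrow> 'a list \<Rightarrow> 'v \<Rightarrow> bool" where
  "dd_path D i u [] v \<longleftrightarrow> u = v"
| "dd_path D i u (a # p) v \<longleftrightarrow> a \<in> arcs D i \<and> tail D a = u \<and> dd_path D (Suc i) (head D a) p v"

definition Sol :: "nat \<Rightarrow> ('v, 'a) dd \<Rightarrow> (nat \<Rightarrow> real) set" where
  "Sol n D = {\<lambda>i\<in>{1..n}. label D (p ! (i - 1)) | p.
                length p = n \<and> dd_path D 1 (root_node D) p (terminal_node D)}"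

definition arcs_to :: "('v, 'a) dd \<Rightarrow> nat \<Rightarrow> 'v \<Rightarrow> 'a set" where
  "arcs_to D l u = {a \<in> arcs D l. \<exists>p. dd_path D 1 (root_node D) p u \<and> a \<in> set p}"

definition rel_subdomain :: "('v, 'a) dd \<Rightarrow> nat \<Rightarrow> 'v \<Rightarrow> real set" where
  "rel_subdomain D l u = {Min (label D ` arcs_to D l u)..Max (label D ` arcs_to D l u)}"

definition new_node :: "('v, 'a) dd \<Rightarrow> 'v \<Rightarrow> bool" where
  "new_node D v \<longleftrightarrow> (\<forall>i. v \<notin> nodes D i)"

definition new_arc :: "('v, 'a) dd \<Rightarrow> 'a \<Rightarrow> bool" where
  "new_arc D a \<longleftrightarrow> (\<forall>i. a \<notin> arcs D i)"

definition add_node :: "nat \<Rightarrow> 'v \<Rightarrow> real \<Rightarrow> ('v, 'a) dd \<Rightarrow> ('v, 'a) dd" where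
  "add_node i v \<xi> D = D\<lparr>nodes := (nodes D)(i := insert v (nodes D i)), sval := (sval D)(v := \<xi>)\<rparr>"

definition add_arc :: "nat \<Rightarrow> 'a \<Rightarrow> 'v \<Rightarrow> 'v \<Rightarrow> real \<Rightarrow> ('v, 'a) dd \<Rightarrow> ('v, 'a) dd" where
  "add_arc i a u v c D = D\<lparr>arcs := (arcs D)(i := insert a (arcs D i)),
     tail := (tail D)(a := u), head := (head D)(a := v), label := (label D)(a := c)\<rparr>"


section \<open>The procedure\<close>

text \<open>
  The procedure is nondeterministic (choice of the lower bounds, merging policy, order of the loops,
  names of new nodes and arcs), hence a relation between diagrams. \<open>run R xs\<close> executes the loop with
  body \<open>R\<close> over the list \<open>xs\<close>.
\<close>

fun run :: "('x \<Rightarrow> 's \<Rightarrow> 's \<Rightarrow> bool) \<Rightarrow> 'x list \<Rightarrow> 's \<Rightarrow> 's \<Rightarrow> bool" where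
  "run R [] s t \<longleftrightarrow> s = t"
| "run R (x # xs) s t \<longleftrightarrow> (\<exists>s'. R x s s' \<and> run R xs s' t)"

definition initial_dd :: "nat \<Rightarrow> ('v, 'a) dd \<Rightarrow> bool" where
  "initial_dd n D \<longleftrightarrow>
     root_node D \<noteq> terminal_node D \<and> sval D (root_node D) = 0 \<and>
     nodes D = (\<lambda>i. {})(1 := {root_node D}, n + 1 := {terminal_node D}) \<and> arcs D = (\<lambda>i. {})"

definition valid_bound ::
  "problem \<Rightarrow> 'j partition \<Rightarrow> nat \<Rightarrow> ('v, 'a) dd \<Rightarrow> 'v \<Rightarrow> 'j \<Rightarrow> nat \<Rightarrow> real \<Rightarrow> bool" where
  "valid_bound P S i D u j k \<eta> \<longleftrightarrow>
     (\<forall>x. x i \<in> subdomain P S i j \<and> (\<forall>l\<in>scope P k - {i}. x l \<in> rel_subdomain D l u)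
          \<longrightarrow> \<eta> \<le> term_val P k x)"

text \<open>\<open>\<xi>\<close> is a value that the procedure may compute for node \<open>u\<close> of layer \<open>i\<close> and sub-domain \<open>j\<close>.\<close>

definition new_state ::
  "problem \<Rightarrow> 'j partition \<Rightarrow> nat \<Rightarrow> ('v, 'a) dd \<Rightarrow> 'v \<Rightarrow> 'j \<Rightarrow> real \<Rightarrow> bool" where
  "new_state P S i D u j \<xi> \<longleftrightarrow>
     (\<exists>\<eta>. (\<forall>k\<in>{1..nterms P}.
             if i = Max (scope P k) then valid_bound P S i D u j k (\<eta> k) else \<eta> k = 0) \<and>
          \<xi> = sval D u + (\<Sum>k = 1..nterms P. \<eta> k))"

definition add_arc_pair ::
  "'j partition \<Rightarrow> nat \<Rightarrow> 'v \<Rightarrow> 'j \<Rightarrow> 'v \<Rightarrow> ('v, 'a) dd \<Rightarrow> ('v, 'a) dd \<Rightarrow> bool" where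
  "add_arc_pair S i u j v D D' \<longleftrightarrow>
     (\<exists>a a'. a \<noteq> a' \<and> new_arc D a \<and> new_arc D a' \<and>
        D' = add_arc i a' u v (sub_hi S i j) (add_arc i a u v (sub_lo S i j) D))"

inductive branch ::
  "problem \<Rightarrow> 'j partition \<Rightarrow> nat \<Rightarrow> 'v \<times> 'j \<Rightarrow> ('v, 'a) dd \<Rightarrow> ('v, 'a) dd \<Rightarrow> bool"
  for P S i where
  create: "branch P S i (u, j) D D'"
    if "i < nvars P" "new_state P S i D u j \<xi>"
      "\<forall>v\<in>nodes D (i + 1). sval D v \<noteq> \<xi>" "new_node D v"
      "add_arc_pair S i u j v (add_node (i + 1) v \<xi> D) D'"
| reuse: "branch P S i (u, j) D D'"
    if "i < nvars P" "new_state P S i D u j \<xi>"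
      "v \<in> nodes D (i + 1)" "sval D v = \<xi>"
      "add_arc_pair S i u j v D D'"
| accept: "branch P S i (u, j) D D'"
    if "i = nvars P" "new_state P S i D u j \<xi>" "\<xi> \<le> rhs P"
      "add_arc_pair S i u j (terminal_node D) D D'"
| reject: "branch P S i (u, j) D D"
    if "i = nvars P" "new_state P S i D u j \<xi>" "\<not> \<xi> \<le> rhs P"

definition expand_layer ::
  "problem \<Rightarrow> 'j partition \<Rightarrow> nat \<Rightarrow> ('v, 'a) dd \<Rightarrow> ('v, 'a) dd \<Rightarrow> bool" where
  "expand_layer P S i D D' \<longleftrightarrow>
     (\<exists>ps. distinct ps \<and> set ps = nodes D i \<times> idx S i \<and> run (branch P S i) ps D D')"

text \<open>
  The set \<open>V\<close> of nodes of layer \<open>i\<close> is replaced by the node \<open>w\<close>. Merging happens before any arc leaving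
  \<open>V\<close> exists, so only heads of arcs have to be redirected.
\<close>

definition merge_nodes :: "nat \<Rightarrow> 'v set \<Rightarrow> 'v \<Rightarrow> ('v, 'a) dd \<Rightarrow> ('v, 'a) dd" where
  "merge_nodes i V w D = D\<lparr>nodes := (nodes D)(i := insert w (nodes D i - V)),
     head := (\<lambda>a. if head D a \<in> V then w else head D a),
     sval := (sval D)(w := Min (sval D ` V))\<rparr>"

definition merge_into_new ::
  "nat \<Rightarrow> 'v set \<Rightarrow> ('v, 'a) dd \<Rightarrow> ('v, 'a) dd \<Rightarrow> bool" where
  "merge_into_new i V D D' \<longleftrightarrow> (\<exists>w. new_node D w \<and> D' = merge_nodes i V w D)"

text \<open>
  The possible outcomes of applying a merging oracle with width limit \<open>\<omega>\<close> to layer \<open>i\<close>; as the policy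
  is arbitrary, an oracle is any selection of disjoint sets \<open>Vs\<close> of nodes respecting the limit.
\<close>

definition merge_layer :: "nat \<Rightarrow> nat \<Rightarrow> ('v, 'a) dd \<Rightarrow> ('v, 'a) dd \<Rightarrow> bool" where
  "merge_layer \<omega> i D D' \<longleftrightarrow>
     (\<exists>Vs. distinct Vs \<and> disjoint (set Vs) \<and> (\<forall>V\<in>set Vs. V \<noteq> {} \<and> V \<subseteq> nodes D i) \<and>
           run (merge_into_new i) Vs D D' \<and> card (nodes D' i) \<le> \<omega>)"

definition layer_step ::
  "problem \<Rightarrow> 'j partition \<Rightarrow> nat \<Rightarrow> nat \<Rightarrow> ('v, 'a) dd \<Rightarrow> ('v, 'a) dd \<Rightarrow> bool" where
  "layer_step P S \<omega> i D D'' \<longleftrightarrow>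
     (\<exists>D'. expand_layer P S i D D' \<and>
           (if i < nvars P then merge_layer \<omega> (i + 1) D' D'' else D'' = D'))"

definition relaxed_dd :: "problem \<Rightarrow> 'j partition \<Rightarrow> nat \<Rightarrow> ('v, 'a) dd \<Rightarrow> bool" where
  "relaxed_dd P S \<omega> D \<longleftrightarrow>
     (\<exists>D\<^sub>0. initial_dd (nvars P) D\<^sub>0 \<and> run (layer_step P S \<omega>) [1..<nvars P + 1] D\<^sub>0 D)"


subsection \<open>The procedure yields decision diagrams\<close>

lemma run_invariant:
  assumes "run R xs s t" "I s" "\<And>x s s'. x \<in> set xs \<Longrightarrow> R x s s' \<Longrightarrow> I s \<Longrightarrow> I s'"
  shows "I t"
  using assms
proof (induction xs arbitrary: s)
  case Nil
  then show ?case by simp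
next
  case (Cons x xs)
  from Cons.prems(1) obtain s' where s': "R x s s'" "run R xs s' t" by auto
  have "I s'" using Cons.prems(3)[of x s s'] Cons.prems(2) s'(1) by simp
  show ?case by (rule Cons.IH[OF s'(2) \<open>I s'\<close>]) (use Cons.prems(3) in auto)
qed

lemma run_append: "run R (xs @ ys) s t \<longleftrightarrow> (\<exists>s'. run R xs s s' \<and> run R ys s' t)"
  by (induction xs arbitrary: s) auto

lemma decision_diagram_initial:
  assumes "1 \<le> n" "initial_dd n D"
  shows "decision_diagram n D"
  using assms by (auto simp: decision_diagram_def initial_dd_def disjoint_family_on_def)

lemma decision_diagram_add_node:
  assumes "decision_diagram n D" "i \<in> {1..<n}" "new_node D v"
  shows "decision_diagram n (add_node (i + 1) v \<xi> D)"
  using assms unfolding decision_diagram_def add_node_def new_node_def disjoint_family_on_def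
  by auto

lemma decision_diagram_add_arc:
  assumes "decision_diagram n D" "i \<in> {1..n}" "new_arc D a" "u \<in> nodes D i" "v \<in> nodes D (i + 1)"
  shows "decision_diagram n (add_arc i a u v c D)"
  using assms unfolding decision_diagram_def add_arc_def new_arc_def disjoint_family_on_def
  by auto

lemma decision_diagram_add_arc_pair:
  assumes "decision_diagram n D" "i \<in> {1..n}" "add_arc_pair S i u j v D D'"
    "u \<in> nodes D i" "v \<in> nodes D (i + 1)"
  shows "decision_diagram n D' \<and> nodes D' = nodes D \<and> (\<forall>l. l \<noteq> i \<longrightarrow> arcs D' l = arcs D l)"
proof -
  from assms(3) obtain a a' where a: "a \<noteq> a'" "new_arc D a" "new_arc D a'"
    and D': "D' = add_arc i a' u v (sub_hi S i j) (add_arc i a u v (sub_lo S i j) D)"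
    by (auto simp: add_arc_pair_def)
  have "decision_diagram n (add_arc i a u v (sub_lo S i j) D)"
    by (rule decision_diagram_add_arc) (use assms a in auto)
  then have "decision_diagram n D'"
    unfolding D'
    by (rule decision_diagram_add_arc) (use assms a in \<open>auto simp: add_arc_def new_arc_def\<close>)
  then show ?thesis by (simp add: D' add_arc_def)
qed

lemma decision_diagram_branch:
  assumes "branch P S i (u, j) D D'" "decision_diagram (nvars P) D" "i \<in> {1..nvars P}"
    "u \<in> nodes D i"
  shows "decision_diagram (nvars P) D' \<and> nodes D' i = nodes D i \<and>
         (\<forall>l. l \<noteq> i \<longrightarrow> arcs D' l = arcs D l)"
  using assms(1)
proof cases
  case (create \<xi> v)
  have "decision_diagram (nvars P) (add_node (i + 1) v \<xi> D)"
    by (rule decision_diagram_add_node) (use assms create in auto)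
  from decision_diagram_add_arc_pair[OF this assms(3) create(5)] assms(4)
  show ?thesis by (auto simp: add_node_def)
next
  case (reuse \<xi> v)
  from decision_diagram_add_arc_pair[OF assms(2,3) reuse(5) assms(4) reuse(3)]
  show ?thesis by auto
next
  case (accept \<xi>)
  have "terminal_node D \<in> nodes D (i + 1)"
    using assms(2) accept(1) by (auto simp: decision_diagram_def)
  from decision_diagram_add_arc_pair[OF assms(2,3) accept(4) assms(4) this]
  show ?thesis by auto
next
  case reject
  then show ?thesis using assms by auto
qed

lemma decision_diagram_expand_layer:
  assumes "expand_layer P S i D D'" "decision_diagram (nvars P) D" "i \<in> {1..nvars P}"
  shows "decision_diagram (nvars P) D' \<and> (\<forall>l. l \<noteq> i \<longrightarrow> arcs D' l = arcs D l)"
proof -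
  let ?I = "\<lambda>E. decision_diagram (nvars P) E \<and> nodes E i = nodes D i \<and>
                (\<forall>l. l \<noteq> i \<longrightarrow> arcs E l = arcs D l)"
  from assms(1) obtain ps where ps: "set ps = nodes D i \<times> idx S i" "run (branch P S i) ps D D'"
    by (auto simp: expand_layer_def)
  have "?I D'"
  proof (rule run_invariant[OF ps(2)])
    fix x E E'
    assume x: "x \<in> set ps" "branch P S i x E E'" and E: "?I E"
    obtain u j where "x = (u, j)" by (cases x)
    with decision_diagram_branch[of P S i u j E E'] x E ps(1) assms(3) show "?I E'" by auto
  qed (use assms in auto)
  then show ?thesis by blast
qed

lemma decision_diagram_merge_nodes:
  assumes D: "decision_diagram n D" and i: "i \<in> {1..<n}" and w: "new_node D w"
    and no_arcs: "arcs D (i + 1) = {}"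
  shows "decision_diagram n (merge_nodes (i + 1) (V \<inter> nodes D (i + 1)) w D)"
proof -
  have layer: "l = m" if "v \<in> nodes D l" "v \<in> nodes D m" for v l m
    using D that unfolding decision_diagram_def disjoint_family_on_def by blast
  let ?E = "merge_nodes (i + 1) (V \<inter> nodes D (i + 1)) w D"
  have "tail ?E a \<in> nodes ?E l \<and> head ?E a \<in> nodes ?E (l + 1)"
    if "l \<in> {1..n}" "a \<in> arcs D l" for l a
  proof -
    have t: "tail D a \<in> nodes D l" and h: "head D a \<in> nodes D (l + 1)"
      using D that by (auto simp: decision_diagram_def)
    have "l \<noteq> i + 1" using that no_arcs by auto
    then have "tail ?E a \<in> nodes ?E l" using t by (simp add: merge_nodes_def)
    moreover have "head ?E a \<in> nodes ?E (l + 1)"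
    proof (cases "l = i")
      case True
      then show ?thesis using h by (auto simp: merge_nodes_def)
    next
      case False
      then have "head D a \<notin> nodes D (i + 1)" using h layer[of "head D a" "l + 1" "i + 1"] by auto
      then show ?thesis using h False by (simp add: merge_nodes_def)
    qed
    ultimately show ?thesis ..
  qed
  moreover have "disjoint_family (nodes ?E)"
    using layer w by (fastforce simp: merge_nodes_def new_node_def disjoint_family_on_def)
  ultimately show ?thesis
    using D i unfolding decision_diagram_def by (auto simp: merge_nodes_def)
qed

lemma decision_diagram_merge_layer:
  assumes "merge_layer \<omega> (i + 1) D D'" "decision_diagram n D" "i \<in> {1..<n}" "arcs D (i + 1) = {}"
  shows "decision_diagram n D' \<and> arcs D' = arcs D"
proof -
  from assms(1) obtain Vs where Vs: "distinct Vs" "disjoint (set Vs)"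
    "\<forall>V\<in>set Vs. V \<subseteq> nodes D (i + 1)" "run (merge_into_new (i + 1)) Vs D D'"
    by (auto simp: merge_layer_def)
  show ?thesis
    using Vs assms(2,4)
  proof (induction Vs arbitrary: D)
    case Nil
    then show ?case by simp
  next
    case (Cons V Vs)
    from Cons.prems(4) obtain E where "merge_into_new (i + 1) V D E"
      and run: "run (merge_into_new (i + 1)) Vs E D'" by auto
    then obtain w where w: "new_node D w" and "E = merge_nodes (i + 1) V w D"
      by (auto simp: merge_into_new_def)
    with run have run: "run (merge_into_new (i + 1)) Vs (merge_nodes (i + 1) V w D) D'" by simp
    let ?E = "merge_nodes (i + 1) V w D"
    have "V \<inter> nodes D (i + 1) = V" using Cons.prems(3) by auto
    then have E: "decision_diagram n ?E"
      using decision_diagram_merge_nodes[of n D i w V] Cons.prems(5,6) assms(3) w by simp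
    have "W \<inter> V = {}" if "W \<in> set Vs" for W
      using Cons.prems(1,2) that by (auto simp: disjoint_def)
    then have "\<forall>W\<in>set Vs. W \<subseteq> nodes ?E (i + 1)"
      using Cons.prems(3) by (fastforce simp: merge_nodes_def)
    moreover have "disjoint (set Vs)" "distinct Vs"
      using Cons.prems(1,2) by (auto simp: pairwise_insert)
    ultimately have "decision_diagram n D' \<and> arcs D' = arcs ?E"
      using Cons.IH[of ?E] E run Cons.prems(6) by (simp add: merge_nodes_def)
    then show ?case by (simp add: merge_nodes_def)
  qed
qed

theorem relaxed_dd_decision_diagram:
  assumes "problem_wf P" "relaxed_dd P S \<omega> D"
  shows "decision_diagram (nvars P) D"
proof -
  let ?n = "nvars P"
  from assms(2) obtain D0 where D0: "initial_dd ?n D0" "run (layer_step P S \<omega>) [1..<?n + 1] D0 D"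
    by (auto simp: relaxed_dd_def)
  have "m \<le> ?n \<Longrightarrow> run (layer_step P S \<omega>) [1..<m + 1] D0 E \<Longrightarrow>
          decision_diagram ?n E \<and> (\<forall>l>m. arcs E l = {})" for m E
  proof (induction m arbitrary: E)
    case 0
    then show ?case
      using D0(1) assms(1) decision_diagram_initial[of ?n D0]
      by (simp add: problem_wf_def initial_dd_def)
  next
    case (Suc m)
    have "[1..<Suc m + 1] = [1..<m + 1] @ [Suc m]" by simp
    then have "run (layer_step P S \<omega>) ([1..<m + 1] @ [Suc m]) D0 E" using Suc.prems(2) by metis
    then obtain E' where E': "run (layer_step P S \<omega>) [1..<m + 1] D0 E'"
      and step: "layer_step P S \<omega> (Suc m) E' E"
      unfolding run_append run.simps by metis
    from step obtain F where F: "expand_layer P S (Suc m) E' F"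
      and E: "if Suc m < ?n then merge_layer \<omega> (Suc m + 1) F E else E = F"
      by (auto simp: layer_step_def)
    have IH: "decision_diagram ?n E'" "\<forall>l>m. arcs E' l = {}"
      using Suc.IH[OF _ E'] Suc.prems(1) by auto
    have F': "decision_diagram ?n F" "\<forall>l>Suc m. arcs F l = {}"
      using decision_diagram_expand_layer[OF F IH(1)] IH(2) Suc.prems(1) by auto
    show ?case
    proof (cases "Suc m < ?n")
      case True
      then have "merge_layer \<omega> (Suc m + 1) F E" using E by simp
      from decision_diagram_merge_layer[OF this F'(1)] True F'(2) show ?thesis by auto
    next
      case False
      then show ?thesis using E F' by simp
    qed
  qed
  from this[of ?n D] D0(2) show ?thesis by simp
qed

end

theory Submission
  imports Defs
begin

text \<open>
  Fix a feasible point \<open>x\<close> and choose for every \<open>l\<close> a sub-domain \<open>J l\<close> containing \<open>x l\<close>. The diagram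
  contains a sequence of nodes \<open>u\<close> from the root to the terminal whose consecutive members are joined
  by two arcs labelled with the endpoints of the sub-domain \<open>J l\<close>. This sequence is found layer
  by layer: by construction \<open>x l\<close> lies in the relative sub-domains of the last node, so every \<open>\<eta>\<close> is
  at most the true value of its term at \<open>x\<close>; the state value is therefore at most the sum of the terms
  already evaluated, merging only lowers it, and the last layer does not reject \<open>x\<close>. The paths along \<open>u\<close>
  encode all vertices of a box that contains \<open>x\<close>.
\<close>

section \<open>Boxes and their vertices\<close>

text \<open>Coordinates are freed from their endpoints one at a time: a point is a convex
  combination of the two points obtained by moving one coordinate to the ends of its
  interval.\<close>

lemma box_subset_convex_hull_vertices:
  fixes lo hi :: "'i \<Rightarrow> real"
  assumes "finite I"
  shows "PiE I (\<lambda>i. {lo i..hi i}) \<subseteq> convex hull (PiE I (\<lambda>i. {lo i, hi i}))"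
proof -
  let ?H = "convex hull (PiE I (\<lambda>i. {lo i, hi i}))"
  \<comment> \<open>\<open>A\<close> collects the coordinates that may range over their whole
    interval: \<open>A = {}\<close> gives the vertices and \<open>A = I\<close> the box.\<close>
  have "finite A \<Longrightarrow> A \<subseteq> I \<Longrightarrow>
      x \<in> PiE I (\<lambda>i. if i \<in> A then {lo i..hi i} else {lo i, hi i}) \<Longrightarrow> x \<in> ?H" for A x
  proof (induction A arbitrary: x rule: finite_induct)
    case empty
    then show ?case by (simp add: hull_inc)
  next
    case (insert i A)
    have xi: "lo i \<le> x i" "x i \<le> hi i" and "i \<in> I"
      using insert.prems by (auto simp: PiE_iff)
    then obtain t where t: "0 \<le> t" "t \<le> 1" "x i = (1 - t) * lo i + t * hi i"
      using closed_segment_eq_real_ivl1[of "lo i" "hi i"]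
      by (fastforce simp: closed_segment_def set_eq_iff)
    have upd: "x(i := c) \<in> ?H" if "c \<in> {lo i, hi i}" for c
    proof (rule insert.IH)
      show "x(i := c) \<in> PiE I (\<lambda>i. if i \<in> A then {lo i..hi i} else {lo i, hi i})"
        using insert.prems insert.hyps(2) that \<open>i \<in> I\<close>
        by (auto simp: PiE_iff extensional_def split: if_splits)
    qed (use insert.prems in simp)
    have "(1 - t) *\<^sub>R x(i := lo i) + t *\<^sub>R x(i := hi i) \<in> ?H"
      using t upd by (intro convexD[OF convex_convex_hull]) auto
    moreover have "(1 - t) *\<^sub>R x(i := lo i) + t *\<^sub>R x(i := hi i) = x"
      using t(3) by (auto simp: fun_eq_iff algebra_simps)
    ultimately show ?case by simp
  qed
  from this[of I] assms show ?thesis by (auto simp: PiE_iff)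
qed


section \<open>Chains of doubled arcs\<close>

text \<open>Only existence is asked for, possibly of a single arc when the two endpoints coincide,
  so the property survives the addition of fresh arcs.\<close>

definition arc_pair :: "('v, 'a) dd \<Rightarrow> 'j partition \<Rightarrow> nat \<Rightarrow> 'v \<Rightarrow> 'j \<Rightarrow> 'v \<Rightarrow> bool" where
  "arc_pair D S l u j v \<longleftrightarrow>
     (\<forall>c\<in>{sub_lo S l j, sub_hi S l j}. \<exists>a\<in>arcs D l. tail D a = u \<and> head D a = v \<and> label D a = c)"

text \<open>The \<open>m\<close> pairs join the \<open>m + 1\<close> nodes \<open>u 1\<close>, ...,
  \<open>u (Suc m)\<close>; the other values of \<open>u\<close> are arbitrary.\<close>

definition chain :: "('v, 'a) dd \<Rightarrow> 'j partition \<Rightarrow> (nat \<Rightarrow> 'j) \<Rightarrow> nat \<Rightarrow> (nat \<Rightarrow> 'v) \<Rightarrow> bool" where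
  "chain D S J m u \<longleftrightarrow>
     u 1 = root_node D \<and> (\<forall>l\<in>{1..m}. arc_pair D S l (u l) (J l) (u (Suc l)))"

lemma dd_path_map:
  assumes "i \<le> m" "\<forall>l\<in>{i..<m}. a l \<in> arcs D l \<and> tail D (a l) = u l \<and> head D (a l) = u (Suc l)"
  shows "dd_path D i (u i) (map a [i..<m]) (u m)"
  using assms
proof (induction rule: inc_induct)
  case base
  then show ?case by simp
next
  case (step k)
  then show ?case by (simp add: upt_conv_Cons)
qed

text \<open>Both arcs of a pair join the same two nodes, so the endpoints can be picked
  independently in each layer.\<close>

lemma chain_path:
  assumes "chain D S J m u" "\<forall>l\<in>{1..m}. c l \<in> {sub_lo S l (J l), sub_hi S l (J l)}"
  obtains a where "\<forall>l\<in>{1..m}. a l \<in> arcs D l \<and> label D (a l) = c l"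
    "dd_path D 1 (root_node D) (map a [1..<Suc m]) (u (Suc m))"
proof -
  have "\<forall>l\<in>{1..m}. \<exists>b. b \<in> arcs D l \<and> tail D b = u l \<and> head D b = u (Suc l) \<and> label D b = c l"
    using assms unfolding chain_def arc_pair_def by blast
  then obtain a where a: "\<forall>l\<in>{1..m}. a l \<in> arcs D l \<and> tail D (a l) = u l \<and>
      head D (a l) = u (Suc l) \<and> label D (a l) = c l"
    using bchoice[of "{1..m}"] by metis
  have "dd_path D 1 (u 1) (map a [1..<Suc m]) (u (Suc m))"
    by (rule dd_path_map) (use a in auto)
  with a that show thesis using assms(1) by (auto simp: chain_def)
qed

text \<open>One path through the lower endpoints and one through the upper endpoints reach the last
  node, so both labels of layer \<open>l\<close> enter the minimum and the maximum; further arcs can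
  only widen the interval.\<close>

lemma chain_rel_subdomain:
  assumes "chain D S J m u" "l \<in> {1..m}" "finite (arcs D l)"
  shows "{sub_lo S l (J l)..sub_hi S l (J l)} \<subseteq> rel_subdomain D l (u (Suc m))"
proof -
  let ?L = "label D ` arcs_to D l (u (Suc m))"
  have "c l \<in> ?L" if "\<forall>l\<in>{1..m}. c l \<in> {sub_lo S l (J l), sub_hi S l (J l)}" for c
  proof -
    from chain_path[OF assms(1) that] obtain a
      where a: "\<forall>l\<in>{1..m}. a l \<in> arcs D l \<and> label D (a l) = c l"
        "dd_path D 1 (root_node D) (map a [1..<Suc m]) (u (Suc m))" .
    then have "a l \<in> arcs_to D l (u (Suc m))"
      using assms(2) unfolding arcs_to_def
      by (intro CollectI conjI exI[of _ "map a [1..<Suc m]"]) (auto simp del: upt_Suc)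
    then show ?thesis using a(1) assms(2) by force
  qed
  from this[of "\<lambda>l. sub_lo S l (J l)"] this[of "\<lambda>l. sub_hi S l (J l)"]
  have "sub_lo S l (J l) \<in> ?L" "sub_hi S l (J l) \<in> ?L" by auto
  moreover have "finite ?L" using assms(3) by (simp add: arcs_to_def)
  ultimately have "Min ?L \<le> sub_lo S l (J l)" "sub_hi S l (J l) \<le> Max ?L" by auto
  then show ?thesis by (auto simp: rel_subdomain_def)
qed

lemma chain_vertices_subset_Sol:
  assumes "chain D S J n u" "u (Suc n) = terminal_node D"
  shows "PiE {1..n} (\<lambda>l. {sub_lo S l (J l), sub_hi S l (J l)}) \<subseteq> Sol n D"
proof
  fix c assume c: "c \<in> PiE {1..n} (\<lambda>l. {sub_lo S l (J l), sub_hi S l (J l)})"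
  from c have "\<forall>l\<in>{1..n}. c l \<in> {sub_lo S l (J l), sub_hi S l (J l)}" by (auto simp: PiE_iff)
  from chain_path[OF assms(1) this] obtain a
    where a: "\<forall>l\<in>{1..n}. a l \<in> arcs D l \<and> label D (a l) = c l"
      "dd_path D 1 (root_node D) (map a [1..<Suc n]) (u (Suc n))" .
  \<comment> \<open>Outside \<open>{1..n}\<close> both sides are \<open>undefined\<close>; inside,
    entry \<open>i - 1\<close> of the list is the arc \<open>a i\<close>, as lists count from
    0.\<close>
  have "c = (\<lambda>i\<in>{1..n}. label D (map a [1..<Suc n] ! (i - 1)))"
  proof
    fix i
    show "c i = (\<lambda>i\<in>{1..n}. label D (map a [1..<Suc n] ! (i - 1))) i"
      using a(1) c by (cases "i \<in> {1..n}") (auto simp: PiE_iff extensional_def simp del: upt_Suc)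
  qed
  then show "c \<in> Sol n D"
    using a(2) assms(2) unfolding Sol_def
    by (intro CollectI exI[of _ "map a [1..<Suc n]"]) (simp del: upt_Suc)
qed

text \<open>\<open>chain\<close> does not record membership in layers: \<open>u 1\<close> is the
  root, and each later node is the head of an arc of the preceding layer.\<close>

lemma chain_node:
  assumes "decision_diagram n D" "chain D S J m u" "l \<in> {1..Suc m}" "m \<le> n"
  shows "u l \<in> nodes D l"
proof (cases "l = 1")
  case True
  then show ?thesis using assms by (simp add: chain_def decision_diagram_def)
next
  case False
  then obtain k where k: "l = Suc k" "k \<in> {1..m}" using assms(3) by (cases l) auto
  then obtain a where "a \<in> arcs D k" "head D a = u l"
    using assms(2) unfolding chain_def arc_pair_def by blast
  moreover have "k \<in> {1..n}" using k(2) assms(4) by simp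
  ultimately show ?thesis using assms(1) k(1) unfolding decision_diagram_def by fastforce
qed


section \<open>Expanding a layer\<close>

text \<open>Captures steps that only add to the diagram. Merging is not of this kind, since it
  deletes nodes and redirects heads.\<close>

definition extends :: "('v, 'a) dd \<Rightarrow> ('v, 'a) dd \<Rightarrow> bool" where
  "extends D D' \<longleftrightarrow> root_node D' = root_node D \<and>
     (\<forall>l. nodes D l \<subseteq> nodes D' l \<and> arcs D l \<subseteq> arcs D' l \<and>
          (\<forall>v\<in>nodes D l. sval D' v = sval D v) \<and>
          (\<forall>a\<in>arcs D l. tail D' a = tail D a \<and> head D' a = head D a \<and> label D' a = label D a))"

lemma extends_refl: "extends D D"
  by (simp add: extends_def)

lemma extendsD:
  assumes "extends D E"
  shows "root_node E = root_node D"
    "v \<in> nodes D l \<Longrightarrow> v \<in> nodes E l" "v \<in> nodes D l \<Longrightarrow> sval E v = sval D v"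
    "a \<in> arcs D l \<Longrightarrow> a \<in> arcs E l" "a \<in> arcs D l \<Longrightarrow> tail E a = tail D a"
    "a \<in> arcs D l \<Longrightarrow> head E a = head D a" "a \<in> arcs D l \<Longrightarrow> label E a = label D a"
  using assms unfolding extends_def by blast+

lemma extends_trans:
  assumes "extends D E" "extends E F"
  shows "extends D F"
proof -
  note D = extendsD[OF assms(1)] and E = extendsD[OF assms(2)]
  show ?thesis
    unfolding extends_def
  proof (intro conjI allI ballI subsetI)
    show "root_node F = root_node D" using D(1) E(1) by simp
  next
    fix l v assume v: "v \<in> nodes D l"
    show "v \<in> nodes F l" "sval F v = sval D v"
      using E(2,3)[OF D(2)[OF v]] D(3)[OF v] by auto
  next
    fix l a assume a: "a \<in> arcs D l"
    show "a \<in> arcs F l" "tail F a = tail D a" "head F a = head D a" "label F a = label D a"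
      using E(4-7)[OF D(4)[OF a]] D(5-7)[OF a] by auto
  qed
qed

lemma extends_arc_pair:
  assumes "extends D E" "arc_pair D S l u j v"
  shows "arc_pair E S l u j v"
  unfolding arc_pair_def
proof
  fix c assume "c \<in> {sub_lo S l j, sub_hi S l j}"
  then obtain a where "a \<in> arcs D l" "tail D a = u" "head D a = v" "label D a = c"
    using assms(2) unfolding arc_pair_def by blast
  then show "\<exists>a\<in>arcs E l. tail E a = u \<and> head E a = v \<and> label E a = c"
    using extendsD(4-7)[OF assms(1)] by (intro bexI[of _ a]) auto
qed

lemma extends_chain: "extends D E \<Longrightarrow> chain D S J m u \<Longrightarrow> chain E S J m u"
  using extends_arc_pair extendsD(1) unfolding chain_def by metis

lemma extends_add_node: "new_node D v \<Longrightarrow> extends D (add_node i v \<xi> D)"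
  by (auto simp: extends_def add_node_def new_node_def)

lemma extends_add_arc_pair: "add_arc_pair S i u j v D D' \<Longrightarrow> extends D D'"
  by (auto simp: extends_def add_arc_pair_def add_arc_def new_arc_def)

lemma arc_pair_add_arc_pair: "add_arc_pair S i u j v D D' \<Longrightarrow> arc_pair D' S i u j v"
  by (auto simp: arc_pair_def add_arc_pair_def add_arc_def)

lemma extends_branch: "branch P S i uj D D' \<Longrightarrow> extends D D'"
  by (induction rule: branch.induct)
    (blast intro: extends_refl extends_trans extends_add_node extends_add_arc_pair)+

text \<open>Branching from layer \<open>i\<close> adds nodes to layer \<open>i + 1\<close> at most,
  so every pair still in the loop keeps its node in layer \<open>i\<close>.\<close>

lemma run_branch:
  assumes "run (branch P S i) ps D E" "set ps \<subseteq> nodes D i \<times> X" "decision_diagram (nvars P) D"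
    "i \<in> {1..nvars P}"
  shows "decision_diagram (nvars P) E \<and> nodes E i = nodes D i \<and> extends D E"
proof (rule run_invariant[OF assms(1)])
  fix p F F'
  assume p: "p \<in> set ps" "branch P S i p F F'"
    and F: "decision_diagram (nvars P) F \<and> nodes F i = nodes D i \<and> extends D F"
  obtain u j where uj: "p = (u, j)" by (cases p)
  with p(1) F assms(2) have "u \<in> nodes F i" by auto
  with decision_diagram_branch[of P S i u j F F'] p(2) uj F assms(4)
  show "decision_diagram (nvars P) F' \<and> nodes F' i = nodes D i \<and> extends D F'"
    using extends_trans[OF _ extends_branch[OF p(2)]] by auto
qed (use assms in \<open>auto simp: extends_refl\<close>)

text \<open>A bound \<open>B\<close> on all possible new states passes to the created or reused
  node; in the last layer it lies below the right-hand side and thus excludes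
  \<open>reject\<close>.\<close>

lemma branch_child:
  assumes "branch P S i (u, j) D D'" "decision_diagram (nvars P) D"
    "\<And>\<xi>. new_state P S i D u j \<xi> \<Longrightarrow> \<xi> \<le> B" "i = nvars P \<Longrightarrow> B \<le> rhs P"
  shows "\<exists>v. arc_pair D' S i u j v \<and> v \<in> nodes D' (Suc i) \<and> (i < nvars P \<longrightarrow> sval D' v \<le> B)"
  using assms(1)
proof cases
  case (create \<xi> v)
  let ?E = "add_node (i + 1) v \<xi> D"
  have "v \<in> nodes ?E (Suc i)" "sval ?E v = \<xi>" by (auto simp: add_node_def)
  then have "v \<in> nodes D' (Suc i)" "sval D' v = \<xi>"
    using extendsD(2,3)[OF extends_add_arc_pair[OF create(5)]] by auto
  then show ?thesis using arc_pair_add_arc_pair[OF create(5)] assms(3)[OF create(2)] by blast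
next
  case (reuse \<xi> v)
  then have "v \<in> nodes D' (Suc i)" "sval D' v = \<xi>"
    using extendsD(2,3)[OF extends_add_arc_pair[OF reuse(5)]] by auto
  then show ?thesis using arc_pair_add_arc_pair[OF reuse(5)] assms(3)[OF reuse(2)] by blast
next
  case (accept \<xi>)
  have "terminal_node D \<in> nodes D (Suc i)"
    using assms(2) accept(1) by (simp add: decision_diagram_def)
  then have "terminal_node D \<in> nodes D' (Suc i)"
    using extendsD(2)[OF extends_add_arc_pair[OF accept(4)]] by auto
  then show ?thesis using arc_pair_add_arc_pair[OF accept(4)] accept(1) by blast
next
  case (reject \<xi>)
  then show ?thesis using assms(3)[OF reject(3)] assms(4) by auto
qed

section \<open>State values as lower bounds\<close>

text \<open>The exact counterpart at \<open>x\<close> of the state of a node in layer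
  \<open>m + 1\<close>: it sums the terms whose variables all belong to the first \<open>m\<close>
  layers.\<close>

definition partial_val :: "problem \<Rightarrow> nat \<Rightarrow> (nat \<Rightarrow> real) \<Rightarrow> real" where
  "partial_val P m x = (\<Sum>k | k \<in> {1..nterms P} \<and> Max (scope P k) \<le> m. term_val P k x)"

lemma finite_scope: "problem_wf P \<Longrightarrow> k \<in> {1..nterms P} \<Longrightarrow> finite (scope P k)"
  unfolding problem_wf_def by (meson finite_atLeastAtMost finite_subset)

lemma Max_scope: "problem_wf P \<Longrightarrow> k \<in> {1..nterms P} \<Longrightarrow> Max (scope P k) \<in> {1..nvars P}"
  using finite_scope[of P k] Max_in[of "scope P k"] unfolding problem_wf_def by blast

lemma partial_val_0: "problem_wf P \<Longrightarrow> partial_val P 0 x = 0"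
  unfolding partial_val_def by (rule sum.neutral) (use Max_scope[of P] in force)

lemma partial_val_nvars:
  "problem_wf P \<Longrightarrow> partial_val P (nvars P) x = (\<Sum>k = 1..nterms P. term_val P k x)"
  unfolding partial_val_def by (rule sum.cong) (use Max_scope[of P] in force)+

text \<open>In the layer of its last variable a term is bounded over a region that contains
  \<open>x\<close>, because the chain puts the earlier coordinates into the relative sub-domains;
  every other \<open>\<eta> k\<close> is 0.\<close>

lemma new_state_le_partial_val:
  assumes "problem_wf P" "chain D S J m u" "\<forall>l. finite (arcs D l)"
    and x: "\<forall>l\<in>{1..Suc m}. x l \<in> subdomain P S l (J l)"
    and "sval D (u (Suc m)) \<le> partial_val P m x" "Suc m \<le> nvars P"
    and "new_state P S (Suc m) D (u (Suc m)) (J (Suc m)) \<xi>"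
  shows "\<xi> \<le> partial_val P (Suc m) x"
proof -
  let ?K = "{1..nterms P}"
  from assms(7) obtain \<eta> where \<eta>: "\<forall>k\<in>?K. if Suc m = Max (scope P k)
        then valid_bound P S (Suc m) D (u (Suc m)) (J (Suc m)) k (\<eta> k) else \<eta> k = 0"
    and \<xi>: "\<xi> = sval D (u (Suc m)) + (\<Sum>k\<in>?K. \<eta> k)"
    unfolding new_state_def by blast
  have le: "\<eta> k \<le> term_val P k x" if k: "k \<in> ?K" "Max (scope P k) = Suc m" for k
  proof -
    have sc: "scope P k \<subseteq> {1..nvars P}" using assms(1) k(1) by (simp add: problem_wf_def)
    have "x l \<in> rel_subdomain D l (u (Suc m))" if "l \<in> scope P k - {Suc m}" for l
    proof -
      \<comment> \<open>\<open>Suc m\<close> is the largest index of the scope, so the others belong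
        to layers covered by the chain.\<close>
      have "l \<le> Suc m" using Max_ge[OF finite_scope[OF assms(1) k(1)], of l] that k(2) by simp
      then have l: "l \<in> {1..m}" using subsetD[OF sc, of l] that by simp
      then have "x l \<in> subdomain P S l (J l)" using x by simp
      then have "x l \<in> {sub_lo S l (J l)..sub_hi S l (J l)}"
        by (auto simp: subdomain_def bounded_domain_def split: if_splits)
      then show ?thesis using chain_rel_subdomain[OF assms(2) l] assms(3) by blast
    qed
    moreover have "x (Suc m) \<in> subdomain P S (Suc m) (J (Suc m))" using x by simp
    moreover have "valid_bound P S (Suc m) D (u (Suc m)) (J (Suc m)) k (\<eta> k)"
      using bspec[OF \<eta> k(1)] k(2) by simp
    ultimately show ?thesis unfolding valid_bound_def by blast
  qed
  have zero: "\<eta> k = 0" if "k \<in> ?K" "Max (scope P k) \<noteq> Suc m" for k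
    using bspec[OF \<eta> that(1)] that(2) by (simp split: if_splits)
  have "(\<Sum>k\<in>?K. \<eta> k) = (\<Sum>k | k \<in> ?K \<and> Max (scope P k) = Suc m. \<eta> k)"
    by (rule sum.mono_neutral_right) (use zero in auto)
  also have "\<dots> \<le> (\<Sum>k | k \<in> ?K \<and> Max (scope P k) = Suc m. term_val P k x)"
    by (rule sum_mono) (use le in auto)
  finally have "\<xi> \<le> partial_val P m x + (\<Sum>k | k \<in> ?K \<and> Max (scope P k) = Suc m. term_val P k x)"
    using \<xi> assms(5) by simp
  also have "\<dots> = partial_val P (Suc m) x"
  proof -
    \<comment> \<open>Raising \<open>m\<close> by one adds exactly the terms whose last variable is
      \<open>Suc m\<close>.\<close>
    have "{k. k \<in> ?K \<and> Max (scope P k) \<le> Suc m} =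
        {k. k \<in> ?K \<and> Max (scope P k) \<le> m} \<union> {k. k \<in> ?K \<and> Max (scope P k) = Suc m}" by auto
    then show ?thesis unfolding partial_val_def
      by (simp only:) (rule sum.union_disjoint[symmetric], auto)
  qed
  finally show ?thesis .
qed

text \<open>The state value of the terminal is irrelevant, hence the guard on the last conjunct.\<close>

definition tracked ::
  "problem \<Rightarrow> 'j partition \<Rightarrow> (nat \<Rightarrow> 'j) \<Rightarrow> (nat \<Rightarrow> real) \<Rightarrow> nat \<Rightarrow> ('v, 'a) dd \<Rightarrow> (nat \<Rightarrow> 'v) \<Rightarrow> bool" where
  "tracked P S J x m D u \<longleftrightarrow> chain D S J m u \<and> u (Suc m) \<in> nodes D (Suc m) \<and>
     (m < nvars P \<longrightarrow> sval D (u (Suc m)) \<le> partial_val P m x)"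

text \<open>The loop is cut at the pair \<open>(u (Suc m), J (Suc m))\<close>: earlier iterations
  preserve the chain and its last state, this one supplies the next node, later ones preserve the
  result.\<close>

lemma expand_layer_tracked:
  assumes wf: "problem_wf P" and exp: "expand_layer P S (Suc m) D D'"
    and dd: "decision_diagram (nvars P) D" and m: "Suc m \<le> nvars P"
    and tr: "tracked P S J x m D u"
    and J: "\<forall>l\<in>{1..Suc m}. J l \<in> idx S l \<and> x l \<in> subdomain P S l (J l)"
    and feas: "partial_val P (nvars P) x \<le> rhs P"
  shows "\<exists>u. tracked P S J x (Suc m) D' u"
proof -
  let ?i = "Suc m" and ?n = "nvars P"
  from exp obtain ps where ps: "set ps = nodes D ?i \<times> idx S ?i" "run (branch P S ?i) ps D D'"
    by (auto simp: expand_layer_def)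
  have "(u ?i, J ?i) \<in> set ps" using ps(1) tr J by (simp add: tracked_def)
  then obtain ps1 ps2 where split: "ps = ps1 @ (u ?i, J ?i) # ps2" by (meson split_list)
  with ps(2) obtain E F where E: "run (branch P S ?i) ps1 D E"
    and F: "branch P S ?i (u ?i, J ?i) E F" and D': "run (branch P S ?i) ps2 F D'"
    by (auto simp: run_append)
  have i: "?i \<in> {1..?n}" using m by simp
  have ddE: "decision_diagram ?n E" "nodes E ?i = nodes D ?i" and extE: "extends D E"
    using run_branch[OF E _ dd i] ps(1) split by auto
  have ui: "u ?i \<in> nodes D ?i" "u ?i \<in> nodes E ?i" using tr ddE(2) by (auto simp: tracked_def)
  have ddF: "decision_diagram ?n F" "nodes F ?i = nodes D ?i"
    using decision_diagram_branch[OF F ddE(1) i ui(2)] ddE(2) by auto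
  have extF: "extends F D'"
    using run_branch[OF D' _ ddF(1) i] ps(1) split ddF(2) by auto
  have chE: "chain E S J m u" using extends_chain[OF extE] tr by (auto simp: tracked_def)
  have "sval E (u ?i) = sval D (u ?i)" using extendsD(3)[OF extE ui(1)] .
  then have svE: "sval E (u ?i) \<le> partial_val P m x" using tr m by (simp add: tracked_def)
  \<comment> \<open>The lower bounds are chosen in the intermediate diagram \<open>E\<close>, so the
    estimate is applied to the chain there.\<close>
  have "\<xi> \<le> partial_val P ?i x" if "new_state P S ?i E (u ?i) (J ?i) \<xi>" for \<xi>
    by (rule new_state_le_partial_val[OF wf chE _ _ svE m that])
      (use ddE(1) J in \<open>auto simp: decision_diagram_def\<close>)
  then obtain v where v: "arc_pair F S ?i (u ?i) (J ?i) v" "v \<in> nodes F (Suc ?i)"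
    "?i < ?n \<Longrightarrow> sval F v \<le> partial_val P ?i x"
    using branch_child[OF F ddE(1), of "partial_val P ?i x"] feas by auto
  \<comment> \<open>The update touches only the index after the current end of the chain, so the old
    pairs are unaffected.\<close>
  have "chain F S J ?i (u(Suc ?i := v))"
    using extends_chain[OF extends_branch[OF F] chE] v(1)
    by (auto simp: chain_def atLeastAtMostSuc_conv)
  then have "chain D' S J ?i (u(Suc ?i := v))" by (rule extends_chain[OF extF])
  moreover have "v \<in> nodes D' (Suc ?i)" "sval D' v = sval F v"
    using extendsD(2,3)[OF extF v(2)] .
  ultimately show ?thesis using v(3) by (intro exI[of _ "u(Suc ?i := v)"]) (simp add: tracked_def)
qed


section \<open>Merging\<close>

text \<open>Redirecting heads moves the end of the chain to \<open>w\<close> if that end is merged,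
  and the state of \<open>w\<close> is a minimum that includes the state of the old end.\<close>

lemma merge_nodes_tracked:
  assumes dd: "decision_diagram (nvars P) D" and m: "m \<in> {1..<nvars P}"
    and w: "new_node D w" and V: "V \<subseteq> nodes D (Suc m)"
    and tr: "tracked P S J x m D u"
  shows "\<exists>u. tracked P S J x m (merge_nodes (Suc m) V w D) u"
proof -
  let ?E = "merge_nodes (Suc m) V w D"
  define u' where "u' = (\<lambda>l. if l = Suc m \<and> u l \<in> V then w else u l)"
  have ch: "chain D S J m u" using tr by (simp add: tracked_def)
  \<comment> \<open>Earlier nodes lie in other layers, and layers are disjoint.\<close>
  have notin: "u l \<notin> V" if "l \<in> {1..m}" for l
  proof -
    have "u l \<in> nodes D l" by (rule chain_node[OF dd ch]) (use that m in auto)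
    moreover have "nodes D l \<inter> nodes D (Suc m) = {}"
      using dd that by (auto simp: decision_diagram_def disjoint_family_on_def)
    ultimately show ?thesis using V by auto
  qed
  have redirect: "(if u (Suc l) \<in> V then w else u (Suc l)) = u' (Suc l)" if "l \<in> {1..m}" for l
    using notin[of "Suc l"] that by (cases "l = m") (auto simp: u'_def)
  have chE: "chain ?E S J m u'"
    unfolding chain_def
  proof
    \<comment> \<open>Since \<open>m \<ge> 1\<close>, the replaced index \<open>Suc m\<close> is not
      that of the root.\<close>
    show "u' 1 = root_node ?E"
      using ch m by (simp add: u'_def merge_nodes_def chain_def)
    show "\<forall>l\<in>{1..m}. arc_pair ?E S l (u' l) (J l) (u' (Suc l))"
    proof
      fix l assume l: "l \<in> {1..m}"
      then have "arc_pair D S l (u l) (J l) (u (Suc l))" using ch by (simp add: chain_def)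
      moreover have "u' l = u l" using l by (simp add: u'_def)
      ultimately show "arc_pair ?E S l (u' l) (J l) (u' (Suc l))"
        using redirect[OF l] unfolding arc_pair_def by (fastforce simp: merge_nodes_def)
    qed
  qed
  have un: "u (Suc m) \<in> nodes D (Suc m)" using tr by (simp add: tracked_def)
  \<comment> \<open>\<open>w\<close> is fresh, so giving it a state leaves that of an unmerged
    \<open>u (Suc m)\<close> unchanged.\<close>
  then have "u (Suc m) \<noteq> w" using w by (auto simp: new_node_def)
  then have "sval ?E (u' (Suc m)) \<le> sval D (u (Suc m))"
  proof (cases "u (Suc m) \<in> V")
    case True
    have "finite V" using V dd finite_subset unfolding decision_diagram_def by blast
    then show ?thesis using True by (simp add: u'_def merge_nodes_def)
  qed (auto simp: u'_def merge_nodes_def)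
  then have "sval ?E (u' (Suc m)) \<le> partial_val P m x" using tr m by (simp add: tracked_def)
  moreover have "u' (Suc m) \<in> nodes ?E (Suc m)" using un by (auto simp: u'_def merge_nodes_def)
  ultimately show ?thesis using chE by (auto simp: tracked_def)
qed

text \<open>The sets are merged one after the other and each merge may move the end of the chain,
  hence an induction over \<open>Vs\<close> with \<open>D\<close> and \<open>u\<close>
  arbitrary.\<close>

lemma merge_layer_tracked:
  assumes "merge_layer \<omega> (Suc m) D D'" "decision_diagram (nvars P) D" "m \<in> {1..<nvars P}"
    "arcs D (Suc m) = {}" "tracked P S J x m D u"
  shows "\<exists>u. tracked P S J x m D' u"
proof -
  from assms(1) obtain Vs where Vs: "distinct Vs" "disjoint (set Vs)"
    "\<forall>V\<in>set Vs. V \<subseteq> nodes D (Suc m)" "run (merge_into_new (Suc m)) Vs D D'"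
    by (auto simp: merge_layer_def)
  show ?thesis
    using Vs assms(2,4,5)
  proof (induction Vs arbitrary: D u)
    case Nil
    then show ?case by auto
  next
    case (Cons V Vs)
    from Cons.prems(4) obtain F where "merge_into_new (Suc m) V D F"
      "run (merge_into_new (Suc m)) Vs F D'" by auto
    then obtain w where w: "new_node D w"
      and run: "run (merge_into_new (Suc m)) Vs (merge_nodes (Suc m) V w D) D'"
      unfolding merge_into_new_def by blast
    let ?E = "merge_nodes (Suc m) V w D"
    have V: "V \<subseteq> nodes D (Suc m)" using Cons.prems(3) by simp
    then have dd: "decision_diagram (nvars P) ?E"
      using decision_diagram_merge_nodes[OF Cons.prems(5) assms(3) w, of V] Cons.prems(6)
      by (simp add: Int_absorb2)
    obtain u' where u': "tracked P S J x m ?E u'"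
      using merge_nodes_tracked[OF Cons.prems(5) assms(3) w V Cons.prems(7)] by blast
    \<comment> \<open>Disjointness keeps the sets still to be merged inside the layer once
      \<open>V\<close> is removed.\<close>
    have "W \<inter> V = {}" if "W \<in> set Vs" for W
      using Cons.prems(1,2) that by (auto simp: disjoint_def)
    then have "\<forall>W\<in>set Vs. W \<subseteq> nodes ?E (Suc m)"
      using Cons.prems(3) by (fastforce simp: merge_nodes_def)
    moreover have "disjoint (set Vs)" "distinct Vs"
      using Cons.prems(1,2) by (auto simp: pairwise_insert)
    moreover have "arcs ?E (Suc m) = {}" using Cons.prems(6) by (simp add: merge_nodes_def)
    ultimately show ?case using Cons.IH[OF _ _ _ run dd _ u'] by blast
  qed
qed


section \<open>The whole procedure\<close>

lemma relaxed_dd_tracked: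
  assumes wf: "problem_wf P" and "relaxed_dd P S \<omega> D"
    and J: "\<forall>l\<in>{1..nvars P}. J l \<in> idx S l \<and> x l \<in> subdomain P S l (J l)"
    and feas: "partial_val P (nvars P) x \<le> rhs P"
  shows "\<exists>u. tracked P S J x (nvars P) D u"
proof -
  let ?n = "nvars P"
  from assms(2) obtain D0 where D0: "initial_dd ?n D0" "run (layer_step P S \<omega>) [1..<?n + 1] D0 D"
    by (auto simp: relaxed_dd_def)
  \<comment> \<open>\<open>m\<close> counts the processed layers. The absence of arcs beyond them
    lets the next layer of nodes be merged by redirecting heads only.\<close>
  have "m \<le> ?n \<Longrightarrow> run (layer_step P S \<omega>) [1..<m + 1] D0 E \<Longrightarrow>
          decision_diagram ?n E \<and> (\<forall>l>m. arcs E l = {}) \<and> (\<exists>u. tracked P S J x m E u)" for m E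
  proof (induction m arbitrary: E)
    case 0
    \<comment> \<open>Only \<open>u 1\<close> matters before the first layer, and the root state 0
      equals the empty partial sum.\<close>
    have "tracked P S J x 0 D0 (\<lambda>_. root_node D0)"
      using D0(1) wf by (auto simp: tracked_def chain_def initial_dd_def partial_val_0 problem_wf_def)
    then show ?case
      using 0 D0(1) wf decision_diagram_initial[of ?n D0]
      by (auto simp: problem_wf_def initial_dd_def)
  next
    case (Suc m)
    \<comment> \<open>\<open>run\<close> unfolds from the front, so the last layer is split off by
      \<open>run_append\<close>.\<close>
    have "[1..<Suc m + 1] = [1..<m + 1] @ [Suc m]" by simp
    then have "run (layer_step P S \<omega>) ([1..<m + 1] @ [Suc m]) D0 E" using Suc.prems(2) by metis
    then obtain E' where E': "run (layer_step P S \<omega>) [1..<m + 1] D0 E'"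
      and step: "layer_step P S \<omega> (Suc m) E' E"
      unfolding run_append run.simps by metis
    from step obtain F where F: "expand_layer P S (Suc m) E' F"
      and E: "if Suc m < ?n then merge_layer \<omega> (Suc (Suc m)) F E else E = F"
      unfolding layer_step_def Suc_eq_plus1 by blast
    obtain u where IH: "decision_diagram ?n E'" "\<forall>l>m. arcs E' l = {}" "tracked P S J x m E' u"
      using Suc.IH[OF _ E'] Suc.prems(1) by auto
    have ddF: "decision_diagram ?n F" "\<forall>l>Suc m. arcs F l = {}"
      using decision_diagram_expand_layer[OF F IH(1)] IH(2) Suc.prems(1) by auto
    obtain u' where u': "tracked P S J x (Suc m) F u'"
      using expand_layer_tracked[OF wf F IH(1) Suc.prems(1) IH(3) _ feas] J Suc.prems(1) by auto
    show ?case
    proof (cases "Suc m < ?n")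
      case True
      then have mrg: "merge_layer \<omega> (Suc (Suc m)) F E" using E by simp
      have "decision_diagram ?n E \<and> arcs E = arcs F"
        using decision_diagram_merge_layer[of \<omega> "Suc m" F E] mrg ddF True by simp
      moreover have "\<exists>u. tracked P S J x (Suc m) E u"
        by (rule merge_layer_tracked[OF mrg ddF(1) _ _ u']) (use True ddF(2) in auto)
      ultimately show ?thesis using ddF(2) by simp
    next
      case False
      then show ?thesis using E ddF u' by auto
    qed
  qed
  from this[of ?n D] D0(2) show ?thesis by simp
qed

theorem theorem1:
  fixes P :: problem and S :: "'j partition" and \<omega> :: nat and D :: "('v, 'a) dd"
  assumes "problem_wf P"
    and "partition_wf P S"
    and "relaxed_dd P S \<omega> D"
  shows "convex hull (feasible_set P) \<subseteq> convex hull (Sol (nvars P) D)"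
proof (rule hull_minimal)
  let ?n = "nvars P"
  show "feasible_set P \<subseteq> convex hull (Sol ?n D)"
  proof
    fix x assume x: "x \<in> feasible_set P"
    \<comment> \<open>The sub-domains cover each domain; the choice \<open>J\<close>, and with it
      the chain, depends on \<open>x\<close>.\<close>
    have "\<exists>j. j \<in> idx S l \<and> x l \<in> subdomain P S l j" if "l \<in> {1..?n}" for l
    proof -
      have "x l \<in> domain_of P l" using x that by (auto simp: feasible_set_def)
      moreover have "(\<Union>j\<in>idx S l. subdomain P S l j) = domain_of P l"
        using assms(2) that by (simp add: partition_wf_def)
      ultimately show ?thesis by blast
    qed
    then obtain J where J: "\<forall>l\<in>{1..?n}. J l \<in> idx S l \<and> x l \<in> subdomain P S l (J l)"
      by metis
    have "partial_val P ?n x \<le> rhs P"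
      using x partial_val_nvars[OF assms(1)] by (simp add: feasible_set_def)
    from relaxed_dd_tracked[OF assms(1,3) J this] obtain u
      where u: "chain D S J ?n u" "u (Suc ?n) \<in> nodes D (Suc ?n)"
      by (auto simp: tracked_def)
    \<comment> \<open>The terminal is the only node of the last layer.\<close>
    then have "u (Suc ?n) = terminal_node D"
      using relaxed_dd_decision_diagram[OF assms(1,3)] by (simp add: decision_diagram_def)
    then have "PiE {1..?n} (\<lambda>l. {sub_lo S l (J l), sub_hi S l (J l)}) \<subseteq> Sol ?n D"
      by (rule chain_vertices_subset_Sol[OF u(1)])
    \<comment> \<open>The box is real even for integer variables; only its vertices have to be
      encoded by paths.\<close>
    then have "PiE {1..?n} (\<lambda>l. {sub_lo S l (J l)..sub_hi S l (J l)}) \<subseteq> convex hull (Sol ?n D)"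
      by (rule order_trans[OF box_subset_convex_hull_vertices[OF finite_atLeastAtMost] hull_mono])
    moreover have "x \<in> PiE {1..?n} (\<lambda>l. {sub_lo S l (J l)..sub_hi S l (J l)})"
    proof (rule PiE_I)
      fix l assume "l \<in> {1..?n}"
      then have "x l \<in> subdomain P S l (J l)" using J by simp
      then show "x l \<in> {sub_lo S l (J l)..sub_hi S l (J l)}"
        by (auto simp: subdomain_def bounded_domain_def split: if_splits)
    qed (use x in \<open>auto simp: feasible_set_def\<close>)
    ultimately show "x \<in> convex hull (Sol ?n D)" by blast
  qed
qed (rule convex_convex_hull)

end
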